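(* Consider the one-dimensional system of balance laws $\partial_t U+\partial_x F(U)=S(U;\varphi(x))$ discretized by the Gauss-Lobatto DGSEM method with global flux quadrature of degree $p\ge 1$, i.e. in each element $K$ $$\Delta\,\frac{d\mathbf U}{dt}+D_x\mathbf F+\mathcal M^{-1}\mathcal B(\alpha[\![\mathbf F]\!])+\mathcal M^{-1}\mathcal B(\mathcal D[\![\mathbf U]\!])=\Delta\,D_x\,\mathcal I\,\mathbf S .$$ Suppose that the mapping $U\mapsto F(U)$ is invertible and that its inverse $F\mapsto U(F)$ is bounded and uniquely defined. Let $F_0$ be given and let $U_0$ satisfy $F(U_0)=F_0$. Then the scheme admits a nodally continuous discrete steady state $U^*=U^*(F)$ (that is, a solution with $d\mathbf U/dt=0$ in every element and with nodal values matching at all interfaces between elements), obtained by integrating the nonlinear ODE $$\frac{d}{dx}F(x)=S(U(F(x));\varphi(x)),\qquad F(x_{\rm left})=F_0,$$ with the fully implicit continuous collocation RK-LobattoIIIA method with $p+1$ stages, using the elements as integration steps.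
   Context: Mesh and notation. The spatial domain is an interval with left end $x_{\rm left}$, divided into consecutive elements $K$ of width $\Delta$, each mapped linearly onto the reference element $[0,1]$ with coordinate $\xi$. Let $0=\xi_0<\dots<\xi_p=1$ be the $p+1$ Gauss-Lobatto points of $[0,1]$, $w_0,\dots,w_p$ the corresponding quadrature weights, and $\phi_0,\dots,\phi_p$ the degree-$p$ Lagrange basis polynomials at these points. In each element $\mathbf U,\mathbf F,\mathbf S$ are the arrays of nodal values $U_i$, $F_i=F(U_i)$, $S_i=S(U_i;\varphi(x_i))$ at the Gauss-Lobatto points $x_i$ of the element; matrices acting on nodal indices act componentwise on vector-valued quantities. The datum $\varphi$ is continuous. Operators: $\mathcal M=\mathrm{diag}(w_0,\dots,w_p)$; $(D_x)_{ij}=\phi_j'(\xi_i)$; $\mathcal B=\mathrm{diag}(-1,0,\dots,0,1)$; $\mathcal I_{jk}=\int_0^{\xi_j}\phi_k(\xi)\,d\xi$ for $j,k=0,\dots,p$. Interface terms: $[\![\cdot]\!]=(\cdot)^+-(\cdot)^-$ denotes the interface jump at the element endpoints (value in the neighbouring element minus value in the element); in $\mathcal B(\alpha[\![\mathbf F]\!])$ and $\mathcal B(\mathcal D[\![\mathbf U]\!])$ only the entries at the left endpoint (index $0$) and right endpoint (index $p$) matter. They come from numerical fluxes $\alpha F^++(1-\alpha)F+\mathcal D(U^+-U)$, where $\alpha$ is a scalar or matrix weight and $\mathcal D$ a positive definite matrix. At the two ends of the domain the exterior (boundary) data are those of the steady state considered, so that no jump arises there. RK-LobattoIIIA: the matrix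 $\mathcal I$ is the tableau of the $p+1$ stage LobattoIIIA method. Integrating the ODE element by element means that in each element the nodal flux values satisfy $F_i=F_0^K+\Delta\sum_{j=0}^p\mathcal I_{ij}\,S(U(F_j);\varphi(x_j))$, $i=0,\dots,p$, where $F_0^K=F_0$ in the first element and $F_0^K$ is the last nodal value $F_p$ of the left neighbouring element otherwise; the nodal values of $U^*$ are $U^*_i=U(F_i)$.
   Formalization: Existence can fail as stated. Proved: any LobattoIIIA solution with values in the range of F gives the steady state; its existence is proved only if F maps an open set continuously onto all of R^m and S is continuous up to the closure. "Bounded" means U(F) has bounded range. *)

theory Defs
  imports "HOL-Analysis.Analysis" "HOL-Computational_Algebra.Polynomial"
begin

text \<open>
  Nodal indices are natural numbers \<open>i \<le> p\<close>, elements are natural numbers \<open>K < N\<close>, and a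
  nodal array is a function \<open>U K i\<close>. Matrices acting on nodal indices are functions of two
  naturals, of which only the entries with both indices at most \<open>p\<close> are used.
\<close>

section \<open>Gauss-Lobatto quadrature and the nodal operators\<close>

text \<open>
  The Gauss-Lobatto rule on \<open>[0,1]\<close> with \<open>p + 1\<close> points: both end points are nodes, and the
  quadrature has the maximal degree of exactness \<open>2 p - 1\<close> under this constraint. These
  conditions determine the nodes and the weights on \<open>{..p}\<close>.
\<close>

definition gauss_lobatto :: "nat \<Rightarrow> (nat \<Rightarrow> real) \<Rightarrow> (nat \<Rightarrow> real) \<Rightarrow> bool" where
  "gauss_lobatto p \<xi> w \<longleftrightarrow>
     strict_mono_on {..p} \<xi> \<and> \<xi> 0 = 0 \<and> \<xi> p = 1 \<and>
     (\<forall>q::real poly. degree q \<le> 2 * p - 1 \<longrightarrow>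
        (\<Sum>i\<le>p. w i * poly q (\<xi> i)) = integral {0..1} (poly q))"

definition lagrange_basis :: "nat \<Rightarrow> (nat \<Rightarrow> real) \<Rightarrow> nat \<Rightarrow> real poly" where
  "lagrange_basis p \<xi> j =
     (\<Prod>k\<in>{..p} - {j}. smult (1 / (\<xi> j - \<xi> k)) [:- \<xi> k, 1:])"

definition diag_mat :: "(nat \<Rightarrow> real) \<Rightarrow> nat \<Rightarrow> nat \<Rightarrow> real" where
  "diag_mat d i j = (if i = j then d i else 0)"

text \<open>The inverse of the mass matrix \<open>diag_mat w\<close>; Gauss-Lobatto weights are positive.\<close>

definition mass_inv :: "(nat \<Rightarrow> real) \<Rightarrow> nat \<Rightarrow> nat \<Rightarrow> real" where
  "mass_inv w = diag_mat (\<lambda>i. 1 / w i)"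

definition diff_mat :: "nat \<Rightarrow> (nat \<Rightarrow> real) \<Rightarrow> nat \<Rightarrow> nat \<Rightarrow> real" where
  "diff_mat p \<xi> i j = poly (pderiv (lagrange_basis p \<xi> j)) (\<xi> i)"

definition bdry_mat :: "nat \<Rightarrow> nat \<Rightarrow> nat \<Rightarrow> real" where
  "bdry_mat p = diag_mat (\<lambda>i. if i = 0 then - 1 else if i = p then 1 else 0)"

definition int_mat :: "nat \<Rightarrow> (nat \<Rightarrow> real) \<Rightarrow> nat \<Rightarrow> nat \<Rightarrow> real" where
  "int_mat p \<xi> j k = integral {0..\<xi> j} (poly (lagrange_basis p \<xi> k))"

definition nodal_act ::
  "nat \<Rightarrow> (nat \<Rightarrow> nat \<Rightarrow> real) \<Rightarrow> (nat \<Rightarrow> 'a::real_vector) \<Rightarrow> nat \<Rightarrow> 'a" where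
  "nodal_act p A v i = (\<Sum>j\<le>p. A i j *\<^sub>R v j)"

definition mesh_node :: "(nat \<Rightarrow> real) \<Rightarrow> real \<Rightarrow> real \<Rightarrow> nat \<Rightarrow> nat \<Rightarrow> real" where
  "mesh_node \<xi> xl \<Delta> K i = xl + \<Delta> * (real K + \<xi> i)"

section \<open>The semi-discrete scheme\<close>

text \<open>
  The state seen from node \<open>i\<close> of element \<open>K\<close> across the element boundary. \<open>UL\<close> and \<open>UR\<close>
  are the exterior data at the two ends of the domain. At interior nodes, whose entries the
  boundary matrix annihilates, it is the nodal state itself.
\<close>

definition outer_state ::
  "nat \<Rightarrow> nat \<Rightarrow> 'a \<Rightarrow> 'a \<Rightarrow> (nat \<Rightarrow> nat \<Rightarrow> 'a) \<Rightarrow> nat \<Rightarrow> nat \<Rightarrow> 'a" where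
  "outer_state N p UL UR U K i =
     (if i = 0 then (if K = 0 then UL else U (K - 1) p)
      else if i = p then (if Suc K = N then UR else U (Suc K) 0)
      else U K i)"

text \<open>
  The global flux scheme as a relation between the nodal states \<open>U\<close> and their time derivatives
  \<open>V\<close>. The weight \<open>\<alpha>\<close> and the dissipation matrix \<open>\<D>\<close> may differ between elements and
  between the two end points of an element; a scalar weight \<open>c\<close> is the matrix \<open>mat c\<close>.
\<close>

definition dgsem_gf ::
  "nat \<Rightarrow> nat \<Rightarrow> (nat \<Rightarrow> real) \<Rightarrow> (nat \<Rightarrow> real) \<Rightarrow> real \<Rightarrow> real
   \<Rightarrow> (real^'m \<Rightarrow> real^'m) \<Rightarrow> (real^'m \<Rightarrow> 'd \<Rightarrow> real^'m) \<Rightarrow> (real \<Rightarrow> 'd)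
   \<Rightarrow> (nat \<Rightarrow> nat \<Rightarrow> real^'m^'m) \<Rightarrow> (nat \<Rightarrow> nat \<Rightarrow> real^'m^'m) \<Rightarrow> real^'m \<Rightarrow> real^'m
   \<Rightarrow> (nat \<Rightarrow> nat \<Rightarrow> real^'m) \<Rightarrow> (nat \<Rightarrow> nat \<Rightarrow> real^'m) \<Rightarrow> bool" where
  "dgsem_gf N p \<xi> w xl \<Delta> flux S \<phi> \<alpha> \<D> UL UR U V \<longleftrightarrow>
     (\<forall>K<N. \<forall>i\<le>p.
        \<Delta> *\<^sub>R V K i
        + nodal_act p (diff_mat p \<xi>) (\<lambda>j. flux (U K j)) i
        + nodal_act p (mass_inv w) (nodal_act p (bdry_mat p)
            (\<lambda>j. \<alpha> K j *v (flux (outer_state N p UL UR U K j) - flux (U K j)))) i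
        + nodal_act p (mass_inv w) (nodal_act p (bdry_mat p)
            (\<lambda>j. \<D> K j *v (outer_state N p UL UR U K j - U K j))) i
        = \<Delta> *\<^sub>R nodal_act p (diff_mat p \<xi>) (nodal_act p (int_mat p \<xi>)
            (\<lambda>j. S (U K j) (\<phi> (mesh_node \<xi> xl \<Delta> K j)))) i)"

text \<open>
  Nodal states that match at all interfaces and for which the scheme holds with vanishing time
  derivative, the exterior data being those of the state itself.
\<close>

definition nodally_continuous :: "nat \<Rightarrow> nat \<Rightarrow> (nat \<Rightarrow> nat \<Rightarrow> 'a) \<Rightarrow> bool" where
  "nodally_continuous N p U \<longleftrightarrow> (\<forall>K. Suc K < N \<longrightarrow> U K p = U (Suc K) 0)"

definition continuous_steady_state ::
  "nat \<Rightarrow> nat \<Rightarrow> (nat \<Rightarrow> real) \<Rightarrow> (nat \<Rightarrow> real) \<Rightarrow> real \<Rightarrow> real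
   \<Rightarrow> (real^'m \<Rightarrow> real^'m) \<Rightarrow> (real^'m \<Rightarrow> 'd \<Rightarrow> real^'m) \<Rightarrow> (real \<Rightarrow> 'd)
   \<Rightarrow> (nat \<Rightarrow> nat \<Rightarrow> real^'m^'m) \<Rightarrow> (nat \<Rightarrow> nat \<Rightarrow> real^'m^'m)
   \<Rightarrow> (nat \<Rightarrow> nat \<Rightarrow> real^'m) \<Rightarrow> bool" where
  "continuous_steady_state N p \<xi> w xl \<Delta> flux S \<phi> \<alpha> \<D> U \<longleftrightarrow>
     nodally_continuous N p U \<and>
     dgsem_gf N p \<xi> w xl \<Delta> flux S \<phi> \<alpha> \<D> (U 0 0) (U (N - 1) p) U (\<lambda>K i. 0)"

section \<open>The LobattoIIIA method\<close>

text \<open>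
  \<open>Y\<close> are the nodal values produced by the \<open>p + 1\<close> stage LobattoIIIA method (Runge-Kutta matrix
  \<open>int_mat p \<xi>\<close>, abscissae \<open>\<xi>\<close>) for \<open>y' = f x y\<close>, \<open>y xl = y0\<close>, with \<open>N\<close> steps of size \<open>\<Delta>\<close>.
  The last row of the matrix gives the weights, so that the last stage is the starting
  value of the next step.
\<close>

definition lobatto_IIIA ::
  "nat \<Rightarrow> nat \<Rightarrow> (nat \<Rightarrow> real) \<Rightarrow> real \<Rightarrow> real \<Rightarrow> (real \<Rightarrow> 'a::real_vector \<Rightarrow> 'a) \<Rightarrow> 'a
   \<Rightarrow> (nat \<Rightarrow> nat \<Rightarrow> 'a) \<Rightarrow> bool" where
  "lobatto_IIIA N p \<xi> xl \<Delta> f y0 Y \<longleftrightarrow>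
     (\<forall>K<N. \<forall>i\<le>p.
        Y K i = (if K = 0 then y0 else Y (K - 1) p)
          + \<Delta> *\<^sub>R nodal_act p (int_mat p \<xi>) (\<lambda>j. f (mesh_node \<xi> xl \<Delta> K j) (Y K j)) i)"

end

theory Submission
  imports Defs
begin

text \<open>
  Why the theorem holds. On one element the collocation equations say that the vector of nodal
  fluxes is a constant plus \<open>\<Delta> \<I> S\<close>. The Lagrange basis sums to \<open>1\<close>, so the
  differentiation matrix annihilates constants, and applying it gives \<open>D F = \<Delta> D \<I> S\<close>
  exactly. The row of \<open>\<I>\<close> that belongs to the left end point vanishes, so the first stage of
  an element repeats the last stage of the preceding one. The nodal states therefore match at the
  interfaces, all jumps are zero, and both interface terms of the scheme drop out. This is
  \<open>lobatto_IIIA_steady_state\<close>.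

  Existence of a collocation solution is a fixed point problem in each element for all \<open>p + 1\<close>
  stages at once. If the flux maps an open set of states continuously onto the whole space, its
  inverse is continuous by invariance of domain; and since the set of states is bounded, a source
  that is continuous up to the closure is bounded along all conceivable stage values. The stage map
  then sends a large box into itself and has a fixed point by Brouwer's theorem
  (\<open>implicit_rk_stages_exist\<close>). The elements are solved one after the other
  (\<open>lobatto_IIIA_exists\<close>).

  The stage vectors live in a power of a Euclidean space whose exponent \<open>p + 1\<close> is a
  variable, so that they do not form a Euclidean space type. Brouwer's theorem is therefore derived for such finite powers (\<open>brouwer_finite_product\<close>), from Kuhn's
  combinatorial lemma, whose dimension is a natural number.
\<close>

section \<open>Nodal differentiation annihilates constants\<close>

lemma lagrange_basis_at_node:
  assumes "inj_on \<xi> {..p}" "i \<le> p" "j \<le> p"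
  shows "poly (lagrange_basis p \<xi> j) (\<xi> i) = (if i = j then 1 else 0)"
proof (cases "i = j")
  case True
  have "\<xi> j - \<xi> k \<noteq> 0" if "k \<in> {..p} - {j}" for k
    using assms that by (auto dest: inj_onD)
  then have "poly (smult (1 / (\<xi> j - \<xi> k)) [:- \<xi> k, 1:]) (\<xi> j) = 1" if "k \<in> {..p} - {j}" for k
    using that by (simp flip: diff_divide_distrib)
  then show ?thesis
    using True by (simp add: lagrange_basis_def poly_prod del: poly_smult poly_pCons)
next
  case False
  then have "i \<in> {..p} - {j}" using assms by simp
  then show ?thesis
    using False by (auto simp: lagrange_basis_def poly_prod intro!: prod_zero)
qed

lemma degree_lagrange_basis_le:
  assumes "j \<le> p"
  shows "degree (lagrange_basis p \<xi> j) \<le> p"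
proof -
  have "degree (lagrange_basis p \<xi> j)
      \<le> (\<Sum>k\<in>{..p} - {j}. degree (smult (1 / (\<xi> j - \<xi> k)) [:- \<xi> k, 1:]))"
    unfolding lagrange_basis_def by (rule order_trans[OF degree_prod_sum_le]) simp_all
  also have "\<dots> \<le> (\<Sum>k\<in>{..p} - {j}. 1)"
    by (intro sum_mono) simp
  also have "\<dots> = p"
    using assms by simp
  finally show ?thesis .
qed

text \<open>
  Both sides are polynomials of degree at most \<open>p\<close> that agree at the \<open>p + 1\<close> nodes.
\<close>

lemma sum_lagrange_basis:
  assumes "inj_on \<xi> {..p}"
  shows "(\<Sum>j\<le>p. lagrange_basis p \<xi> j) = 1"
proof (rule poly_eqI_degree)
  show "poly (\<Sum>j\<le>p. lagrange_basis p \<xi> j) x = poly 1 x" if "x \<in> \<xi> ` {..p}" for x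
    using that assms by (auto simp: poly_sum lagrange_basis_at_node)
  have "card (\<xi> ` {..p}) = Suc p"
    using assms by (simp add: card_image)
  moreover have "degree (\<Sum>j\<le>p. lagrange_basis p \<xi> j) \<le> p"
    by (intro degree_sum_le degree_lagrange_basis_le) auto
  ultimately show "degree (\<Sum>j\<le>p. lagrange_basis p \<xi> j) < card (\<xi> ` {..p})"
    and "degree (1::real poly) < card (\<xi> ` {..p})"
    by auto
qed

lemma nodal_act_diff_mat_const:
  assumes "inj_on \<xi> {..p}"
  shows "nodal_act p (diff_mat p \<xi>) (\<lambda>j. c) i = 0"
proof -
  have "(\<Sum>j\<le>p. diff_mat p \<xi> i j) = poly (pderiv (\<Sum>j\<le>p. lagrange_basis p \<xi> j)) (\<xi> i)"
    by (simp add: diff_mat_def higher_pderiv_sum[of 1, simplified] poly_sum)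
  also have "\<dots> = 0"
    by (simp add: sum_lagrange_basis[OF assms])
  finally show ?thesis
    by (simp add: nodal_act_def flip: scaleR_sum_left)
qed

section \<open>Collocation solutions are steady states\<close>

lemma nodal_act_zero: "nodal_act p A (\<lambda>j. 0) = (\<lambda>i. 0)"
  by (simp add: nodal_act_def fun_eq_iff)

lemma nodal_act_add_scaleR:
  "nodal_act p A (\<lambda>j. u j + c *\<^sub>R v j) i = nodal_act p A u i + c *\<^sub>R nodal_act p A v i"
  by (simp add: nodal_act_def scaleR_add_right sum.distrib scaleR_sum_right mult.commute)

lemma nodal_act_cong:
  "(\<And>j. j \<le> p \<Longrightarrow> u j = v j) \<Longrightarrow> nodal_act p A u i = nodal_act p A v i"
  by (simp add: nodal_act_def)

text \<open>
  The first row of the Runge-Kutta matrix consists of integrals over the degenerate interval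
  \<open>{0..0}\<close>. This makes the method continuous from step to step.
\<close>

lemma lobatto_IIIA_first_stage:
  assumes "lobatto_IIIA N p \<xi> xl \<Delta> f y0 Y" "K < N" "\<xi> 0 = 0"
  shows "Y K 0 = (if K = 0 then y0 else Y (K - 1) p)"
proof -
  have "Y K 0 = (if K = 0 then y0 else Y (K - 1) p)
      + \<Delta> *\<^sub>R nodal_act p (int_mat p \<xi>) (\<lambda>j. f (mesh_node \<xi> xl \<Delta> K j) (Y K j)) 0"
    using assms unfolding lobatto_IIIA_def by blast
  also have "nodal_act p (int_mat p \<xi>) (\<lambda>j. f (mesh_node \<xi> xl \<Delta> K j) (Y K j)) 0 = 0"
    using assms by (simp add: nodal_act_def int_mat_def)
  finally show ?thesis by simp
qed

text \<open>
  With matching nodal values, and the exterior data taken from the state itself, crossing an element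
  boundary changes nothing: this is the vanishing of all jumps.
\<close>

lemma outer_state_nodally_continuous:
  assumes "nodally_continuous N p U" "K < N"
  shows "outer_state N p (U 0 0) (U (N - 1) p) U K i = U K i"
proof -
  have "U (K - 1) p = U K 0" if "0 < K"
    using assms that by (cases K) (auto simp: nodally_continuous_def)
  moreover have "U K p = U (Suc K) 0" if "Suc K \<noteq> N"
    using assms that unfolding nodally_continuous_def by auto
  ultimately show ?thesis
    by (auto simp: outer_state_def)
qed

text \<open>
  Row by row, the collocation equations are a constant plus \<open>\<Delta> \<I> S\<close>, and differentiation
  kills the constant. Because \<open>u\<close> inverts the flux at the computed nodal values, the scheme
  differentiates exactly these values.
\<close>

lemma lobatto_IIIA_steady_state:
  assumes gl: "gauss_lobatto p \<xi> w"
    and lob: "lobatto_IIIA N p \<xi> xl \<Delta> (\<lambda>x y. S (u y) (\<phi> x)) z Y"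
    and inv: "\<And>K i. K < N \<Longrightarrow> i \<le> p \<Longrightarrow> flux (u (Y K i)) = Y K i"
  shows "continuous_steady_state N p \<xi> w xl \<Delta> flux S \<phi> \<alpha> \<D> (\<lambda>K i. u (Y K i))"
proof -
  have inj: "inj_on \<xi> {..p}" and \<xi>0: "\<xi> 0 = 0"
    using gl by (auto simp: gauss_lobatto_def intro: strict_mono_on_imp_inj_on)
  have "Y K p = Y (Suc K) 0" if "Suc K < N" for K
    using lobatto_IIIA_first_stage[OF lob that \<xi>0] by simp
  then have nc: "nodally_continuous N p (\<lambda>K i. u (Y K i))"
    by (simp add: nodally_continuous_def)
  have D: "nodal_act p (diff_mat p \<xi>) (\<lambda>j. flux (u (Y K j))) i
      = \<Delta> *\<^sub>R nodal_act p (diff_mat p \<xi>) (nodal_act p (int_mat p \<xi>)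
            (\<lambda>j. S (u (Y K j)) (\<phi> (mesh_node \<xi> xl \<Delta> K j)))) i"
    if K: "K < N" for K i
  proof -
    have "nodal_act p (diff_mat p \<xi>) (\<lambda>j. flux (u (Y K j))) i
      = nodal_act p (diff_mat p \<xi>) (\<lambda>j. (if K = 0 then z else Y (K - 1) p)
          + \<Delta> *\<^sub>R nodal_act p (int_mat p \<xi>)
              (\<lambda>j. S (u (Y K j)) (\<phi> (mesh_node \<xi> xl \<Delta> K j))) j) i"
      using lob K inv unfolding lobatto_IIIA_def by (intro nodal_act_cong) metis
    then show ?thesis
      by (simp only: nodal_act_add_scaleR nodal_act_diff_mat_const[OF inj] add_0)
  qed
  show ?thesis
    unfolding continuous_steady_state_def dgsem_gf_def
    using nc D outer_state_nodally_continuous[OF nc] by (simp add: nodal_act_zero)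
qed

section \<open>Brouwer's theorem on finite powers of a box\<close>

lemma tendsto_funI:
  fixes X :: "'k \<Rightarrow> 'i \<Rightarrow> 'a::topological_space"
  assumes "\<And>i. ((\<lambda>k. X k i) \<longlongrightarrow> l i) F"
  shows "(X \<longlongrightarrow> l) F"
proof -
  have "limitin (product_topology (\<lambda>i. euclidean) UNIV) X l F"
    using assms by (simp add: limitin_componentwise)
  then show ?thesis
    by (simp add: euclidean_product_topology)
qed

text \<open>
  Kuhn's lemma on the grid of mesh width \<open>1 / k\<close>: label coordinate \<open>i\<close> of a grid point by the
  direction in which \<open>f\<close> moves it. Some small cube with corner \<open>z\<close> carries both labels in every
  coordinate, so that each coordinate is moved up at a vertex \<open>U i\<close> and down at a vertex \<open>V i\<close>.
  The entries with index at least \<open>n\<close> are fixed at \<open>0\<close> because \<open>f\<close> may depend on them, and the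
  limit \<open>k \<rightarrow> \<infinity>\<close> needs convergence in all of them.
\<close>

lemma cube_almost_fixed:
  fixes f :: "(nat \<Rightarrow> real) \<Rightarrow> nat \<Rightarrow> real"
  assumes f: "\<And>x. x \<in> Pi {..<n} (\<lambda>_. {0..1}) \<Longrightarrow> f x \<in> Pi {..<n} (\<lambda>_. {0..1})"
    and "0 < k"
  shows "\<exists>z U V. (\<forall>j<n. z j \<in> {0..1}) \<and> (\<forall>i<n.
      U i \<in> Pi {..<n} (\<lambda>_. {0..1}) \<and> V i \<in> Pi {..<n} (\<lambda>_. {0..1}) \<and>
      (\<forall>j\<ge>n. U i j = 0 \<and> V i j = 0) \<and>
      (\<forall>j<n. \<bar>U i j - z j\<bar> \<le> 1 / real k \<and> \<bar>V i j - z j\<bar> \<le> 1 / real k) \<and>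
      U i i \<le> f (U i) i \<and> f (V i) i \<le> V i i)"
proof -
  define pt :: "(nat \<Rightarrow> nat) \<Rightarrow> nat \<Rightarrow> real"
    where "pt = (\<lambda>q j. if j < n then real (q j) / real k else 0)"
  \<comment> \<open>Kuhn's lemma prescribes the labels on the faces; this agrees with the direction of motion
      because \<open>f\<close> cannot leave the cube.\<close>
  define label :: "(nat \<Rightarrow> nat) \<Rightarrow> nat \<Rightarrow> nat" where
    "label = (\<lambda>q i. if q i = 0 then 0 else if q i = k then 1
                    else if pt q i \<le> f (pt q) i then 0 else 1)"
  have pt: "pt q \<in> Pi {..<n} (\<lambda>_. {0..1})" if "\<forall>i<n. q i \<le> k" for q
    using that \<open>0 < k\<close> by (auto simp: pt_def)
  have up: "pt q i \<le> f (pt q) i" if "\<forall>i<n. q i \<le> k" "i < n" "label q i = 0" for q i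
    using f[OF pt[OF that(1)]] that by (auto simp: label_def pt_def Pi_iff split: if_splits)
  have down: "f (pt q) i \<le> pt q i" if "\<forall>i<n. q i \<le> k" "i < n" "label q i \<noteq> 0" for q i
    using f[OF pt[OF that(1)]] that \<open>0 < k\<close>
    by (auto simp: label_def pt_def Pi_iff split: if_splits)
  obtain q where q: "\<forall>i<n. q i < k"
    and rs: "\<forall>i<n. \<exists>r s. (\<forall>j<n. q j \<le> r j \<and> r j \<le> q j + 1) \<and>
                (\<forall>j<n. q j \<le> s j \<and> s j \<le> q j + 1) \<and> label r i \<noteq> label s i"
    by (rule kuhn_lemma[OF \<open>0 < k\<close>, of n label]) (use \<open>0 < k\<close> in \<open>auto simp: label_def\<close>)
  have near: "\<bar>pt r j - pt q j\<bar> \<le> 1 / real k" if "\<forall>j<n. q j \<le> r j \<and> r j \<le> q j + 1" "j < n" for r j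
  proof -
    have "\<bar>real (r j) - real (q j)\<bar> \<le> 1"
      using that by (auto simp: abs_le_iff)
    then show ?thesis
      using that \<open>0 < k\<close> by (simp add: pt_def divide_right_mono flip: diff_divide_distrib)
  qed
  have "\<exists>U V. U \<in> Pi {..<n} (\<lambda>_. {0..1}) \<and> V \<in> Pi {..<n} (\<lambda>_. {0..1}) \<and>
      (\<forall>j\<ge>n. U j = 0 \<and> V j = 0) \<and>
      (\<forall>j<n. \<bar>U j - pt q j\<bar> \<le> 1 / real k \<and> \<bar>V j - pt q j\<bar> \<le> 1 / real k) \<and>
      U i \<le> f U i \<and> f V i \<le> V i" if "i < n" for i
  proof -
    obtain r s where r: "\<forall>j<n. q j \<le> r j \<and> r j \<le> q j + 1"
      and s: "\<forall>j<n. q j \<le> s j \<and> s j \<le> q j + 1" and "label r i \<noteq> label s i"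
      using rs \<open>i < n\<close> by metis
    moreover have "label r i = 0 \<or> label s i = 0"
      using \<open>label r i \<noteq> label s i\<close> by (auto simp: label_def split: if_splits)
    ultimately obtain r s where r: "\<forall>j<n. q j \<le> r j \<and> r j \<le> q j + 1"
      and s: "\<forall>j<n. q j \<le> s j \<and> s j \<le> q j + 1" and "label r i = 0" "label s i \<noteq> 0"
      by metis
    moreover have "\<forall>j<n. r j \<le> k" "\<forall>j<n. s j \<le> k"
      using q r s by fastforce+
    ultimately show ?thesis
      using pt[of r] pt[of s] up[of r i] down[of s i] near[of r] near[of s] \<open>i < n\<close>
      by (intro exI[of _ "pt r"] exI[of _ "pt s"]) (auto simp: pt_def)
  qed
  then obtain U V where "\<And>i. i < n \<Longrightarrow>
      U i \<in> Pi {..<n} (\<lambda>_. {0..1}) \<and> V i \<in> Pi {..<n} (\<lambda>_. {0..1}) \<and>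
      (\<forall>j\<ge>n. U i j = 0 \<and> V i j = 0) \<and>
      (\<forall>j<n. \<bar>U i j - pt q j\<bar> \<le> 1 / real k \<and> \<bar>V i j - pt q j\<bar> \<le> 1 / real k) \<and>
      U i i \<le> f (U i) i \<and> f (V i) i \<le> V i i"
    by metis
  moreover have "pt q j \<in> {0..1}" if "j < n" for j
    using pt[of q] q that by (auto simp: Pi_iff less_imp_le)
  ultimately show ?thesis
    by (intro exI[of _ "pt q"] exI[of _ U] exI[of _ V]) simp
qed

text \<open>
  Refine the grid. By compactness the small cubes of \<open>cube_almost_fixed\<close> accumulate at a point
  \<open>x\<close>, to which the vertices moved up and the vertices moved down in coordinate \<open>i\<close> converge
  simultaneously; continuity forces \<open>x i \<le> f x i \<le> x i\<close>.
\<close>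

lemma brouwer_nat_cube:
  fixes f :: "(nat \<Rightarrow> real) \<Rightarrow> nat \<Rightarrow> real"
  assumes cont: "continuous_on (Pi {..<n} (\<lambda>_. {0..1})) f"
    and f: "\<And>x. x \<in> Pi {..<n} (\<lambda>_. {0..1}) \<Longrightarrow> f x \<in> Pi {..<n} (\<lambda>_. {0..1})"
  obtains x where "x \<in> Pi {..<n} (\<lambda>_. {0..1})" "\<And>i. i < n \<Longrightarrow> f x i = x i"
proof -
  let ?C = "Pi {..<n} (\<lambda>_. {0..1::real})"
  have "\<forall>k. \<exists>z U V. (\<forall>j<n. z j \<in> {0..1}) \<and> (\<forall>i<n. U i \<in> ?C \<and> V i \<in> ?C \<and>
      (\<forall>j\<ge>n. U i j = 0 \<and> V i j = 0) \<and>
      (\<forall>j<n. \<bar>U i j - z j\<bar> \<le> 1 / real (Suc k) \<and> \<bar>V i j - z j\<bar> \<le> 1 / real (Suc k)) \<and>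
      U i i \<le> f (U i) i \<and> f (V i) i \<le> V i i)"
    by (intro allI cube_almost_fixed f) auto
  then obtain z U V where "\<forall>k. (\<forall>j<n. z k j \<in> {0..1}) \<and> (\<forall>i<n. U k i \<in> ?C \<and> V k i \<in> ?C \<and>
      (\<forall>j\<ge>n. U k i j = 0 \<and> V k i j = 0) \<and>
      (\<forall>j<n. \<bar>U k i j - z k j\<bar> \<le> 1 / real (Suc k) \<and> \<bar>V k i j - z k j\<bar> \<le> 1 / real (Suc k)) \<and>
      U k i i \<le> f (U k i) i \<and> f (V k i) i \<le> V k i i)"
    unfolding choice_iff by blast
  then have z: "\<And>k j. j < n \<Longrightarrow> z k j \<in> {0..1}"
    and UV: "\<And>k i. i < n \<Longrightarrow> U k i \<in> ?C \<and> V k i \<in> ?C \<and>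
      (\<forall>j\<ge>n. U k i j = 0 \<and> V k i j = 0) \<and>
      (\<forall>j<n. \<bar>U k i j - z k j\<bar> \<le> 1 / real (Suc k) \<and> \<bar>V k i j - z k j\<bar> \<le> 1 / real (Suc k)) \<and>
      U k i i \<le> f (U k i) i \<and> f (V k i) i \<le> V k i i"
    by blast+
  have "\<forall>d\<subseteq>{..<n}. \<exists>l r. strict_mono (r::nat\<Rightarrow>nat) \<and>
      (\<forall>e>0. eventually (\<lambda>k. \<forall>i\<in>d. dist (z (r k) i) (l i) < e) sequentially)"
  proof (rule compact_lemma_general[where proj = "\<lambda>x. x" and unproj = "\<lambda>x. x"])
    show "bounded ((\<lambda>x. x i) ` range z)" if "i \<in> {..<n}" for i
      by (rule bounded_subset[of "{0..1}"]) (use z that in auto)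
  qed auto
  then obtain l r where r: "strict_mono (r::nat\<Rightarrow>nat)"
    and l: "\<And>e. e > 0 \<Longrightarrow> eventually (\<lambda>k. \<forall>i\<in>{..<n}. dist (z (r k) i) (l i) < e) sequentially"
    by blast
  define x where "x = (\<lambda>j. if j < n then l j else 0)"
  have zx: "(\<lambda>k. z (r k) j) \<longlonglongrightarrow> x j" if "j < n" for j
    using that by (auto simp: x_def intro!: tendstoI elim: eventually_mono[OF l])
  have xC: "x \<in> ?C"
  proof
    fix j assume "j \<in> {..<n}"
    then show "x j \<in> {0..1}"
      by (intro Lim_in_closed_set[OF _ _ _ zx]) (use z in auto)
  qed
  have small: "(\<lambda>k. 1 / real (Suc (r k))) \<longlonglongrightarrow> 0"
    using LIMSEQ_subseq_LIMSEQ[OF LIMSEQ_inverse_real_of_nat r]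
    by (simp add: o_def inverse_eq_divide)
  have lim: "W \<longlonglongrightarrow> x"
    if "\<And>k j. n \<le> j \<Longrightarrow> W k j = 0"
      and "\<And>k j. j < n \<Longrightarrow> \<bar>W k j - z (r k) j\<bar> \<le> 1 / real (Suc (r k))" for W
  proof (rule tendsto_funI)
    fix j show "(\<lambda>k. W k j) \<longlonglongrightarrow> x j"
    proof (cases "j < n")
      case True
      have "(\<lambda>k. W k j - z (r k) j) \<longlonglongrightarrow> 0"
        by (rule Lim_null_comparison[OF _ small]) (use that True in auto)
      from tendsto_add[OF this zx[OF True]] show ?thesis by simp
    next
      case False
      then show ?thesis using that by (simp add: x_def)
    qed
  qed
  have "f x i = x i" if i: "i < n" for i
  proof -
    have coord: "(\<lambda>k. W k i) \<longlonglongrightarrow> x i \<and> (\<lambda>k. f (W k) i) \<longlonglongrightarrow> f x i"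
      if W: "W \<longlonglongrightarrow> x" "\<And>k. W k \<in> ?C" for W
    proof
      show "(\<lambda>k. W k i) \<longlonglongrightarrow> x i"
        by (rule continuous_on_tendsto_compose[OF continuous_on_product_coordinates W(1)]) auto
      show "(\<lambda>k. f (W k) i) \<longlonglongrightarrow> f x i"
        by (rule continuous_on_tendsto_compose[OF continuous_on_product_then_coordinatewise[OF cont]
              W(1) xC]) (use W in auto)
    qed
    have Ulim: "(\<lambda>k. U (r k) i) \<longlonglongrightarrow> x" and Vlim: "(\<lambda>k. V (r k) i) \<longlonglongrightarrow> x"
      using UV[OF i] by (auto intro!: lim)
    have U: "(\<lambda>k. U (r k) i i) \<longlonglongrightarrow> x i \<and> (\<lambda>k. f (U (r k) i) i) \<longlonglongrightarrow> f x i"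
      and V: "(\<lambda>k. V (r k) i i) \<longlonglongrightarrow> x i \<and> (\<lambda>k. f (V (r k) i) i) \<longlonglongrightarrow> f x i"
      using coord[OF Ulim] coord[OF Vlim] UV[OF i] by blast+
    have "x i \<le> f x i"
      by (rule LIMSEQ_le[of "\<lambda>k. U (r k) i i" _ "\<lambda>k. f (U (r k) i) i"])
        (use U UV[OF i] in auto)
    moreover have "f x i \<le> x i"
      by (rule LIMSEQ_le[of "\<lambda>k. f (V (r k) i) i" _ "\<lambda>k. V (r k) i i"])
        (use V UV[OF i] in auto)
    ultimately show ?thesis by simp
  qed
  then show ?thesis
    using that xC by blast
qed

text \<open>
  Enumerating the scalar coordinates \<open>I \<times> Basis\<close> and rescaling each of them to \<open>[0,1]\<close> reduces
  the claim to the cube. The parametrization \<open>T\<close> of the boxes by the cube undoes the rescaling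
  \<open>R\<close>, so a fixed point \<open>x\<close> of \<open>R \<circ> f \<circ> T\<close> gives the fixed point \<open>T x\<close> of \<open>f\<close>.
  Fixed points are meant on the coordinates in \<open>I\<close>; \<open>T\<close> freezes all others at \<open>0\<close>.
\<close>

lemma brouwer_finite_product:
  fixes f :: "('i \<Rightarrow> 'a::euclidean_space) \<Rightarrow> 'i \<Rightarrow> 'a"
  assumes "finite I" and "cbox a b \<noteq> {}"
    and cont: "continuous_on (Pi I (\<lambda>_. cbox a b)) f"
    and f: "\<And>x. x \<in> Pi I (\<lambda>_. cbox a b) \<Longrightarrow> f x \<in> Pi I (\<lambda>_. cbox a b)"
  obtains x where "x \<in> Pi I (\<lambda>_. cbox a b)" "\<And>i. i \<in> I \<Longrightarrow> f x i = x i"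
proof -
  define n where "n = card (I \<times> (Basis::'a set))"
  have "finite (I \<times> (Basis::'a set))"
    using \<open>finite I\<close> by simp
  then obtain h where h: "bij_betw h (I \<times> (Basis::'a set)) {..<n}"
    unfolding n_def atLeast0LessThan[symmetric] using ex_bij_betw_finite_nat by blast
  define e where "e = inv_into (I \<times> (Basis::'a set)) h"
  have e: "e k \<in> I \<times> Basis" "h (e k) = k" if "k < n" for k
    using that h bij_betwE[OF bij_betw_inv_into[OF h]] bij_betw_inv_into_right[OF h]
    by (auto simp: e_def)
  have eh: "e (h (i, c)) = (i, c)" "h (i, c) < n" if "i \<in> I" "c \<in> Basis" for i c
    using that h bij_betw_inv_into_left[OF h] bij_betwE[OF h] by (auto simp: e_def)
  define T where "T = (\<lambda>(x::nat \<Rightarrow> real) i.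
    if i \<in> I then (\<Sum>c\<in>Basis. (a \<bullet> c + x (h (i, c)) * ((b - a) \<bullet> c)) *\<^sub>R c) else 0)"
  define R where "R = (\<lambda>(y::'i \<Rightarrow> 'a) k. (y (fst (e k)) - a) \<bullet> snd (e k) / ((b - a) \<bullet> snd (e k)))"
  have le: "a \<bullet> c \<le> b \<bullet> c" if "c \<in> Basis" for c
    using assms(2) that by (auto simp: box_ne_empty)
  have TC: "T x \<in> Pi I (\<lambda>_. cbox a b)" if x: "x \<in> Pi {..<n} (\<lambda>_. {0..1})" for x
  proof
    fix i assume "i \<in> I"
    have "a \<bullet> c \<le> T x i \<bullet> c \<and> T x i \<bullet> c \<le> b \<bullet> c" if "c \<in> Basis" for c
    proof -
      have "T x i \<bullet> c = a \<bullet> c + x (h (i, c)) * ((b - a) \<bullet> c)"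
        using \<open>i \<in> I\<close> \<open>c \<in> Basis\<close> by (simp add: T_def)
      moreover have "0 \<le> x (h (i, c))" "x (h (i, c)) \<le> 1"
        using x eh(2)[OF \<open>i \<in> I\<close> \<open>c \<in> Basis\<close>] by (auto simp: Pi_iff)
      ultimately show ?thesis
        using le[OF \<open>c \<in> Basis\<close>] mult_left_le_one_le[of "(b - a) \<bullet> c" "x (h (i, c))"]
        by (auto simp: inner_diff_left)
    qed
    then show "T x i \<in> cbox a b"
      by (simp add: mem_box)
  qed
  have RC: "R y \<in> Pi {..<n} (\<lambda>_. {0..1})" if y: "y \<in> Pi I (\<lambda>_. cbox a b)" for y
  proof
    fix k assume "k \<in> {..<n}"
    then obtain i c where ic: "e k = (i, c)" "i \<in> I" "c \<in> Basis"
      using e(1)[of k] by auto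
    then have "a \<bullet> c \<le> y i \<bullet> c" "y i \<bullet> c \<le> b \<bullet> c"
      using y by (auto simp: Pi_iff mem_box)
    then show "R y k \<in> {0..1}"
      using ic by (auto simp: R_def inner_diff_left divide_simps)
  qed
  \<comment> \<open>In a degenerate direction, with \<open>(b - a) \<bullet> c = 0\<close>, division by zero makes the rescaled
      coordinate \<open>0\<close>, which \<open>T\<close> maps back to \<open>a \<bullet> c = y i \<bullet> c\<close>.\<close>
  have TR: "T (R y) i = y i" if y: "y \<in> Pi I (\<lambda>_. cbox a b)" and i: "i \<in> I" for y i
  proof (rule euclidean_eqI)
    fix c :: 'a assume c: "c \<in> Basis"
    have "a \<bullet> c \<le> y i \<bullet> c" "y i \<bullet> c \<le> b \<bullet> c"
      using y i c by (auto simp: Pi_iff mem_box)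
    then show "T (R y) i \<bullet> c = y i \<bullet> c"
      using i c by (auto simp: T_def R_def eh inner_diff_left divide_simps)
  qed
  have contT: "continuous_on A T" for A
    unfolding T_def
  proof (rule continuous_on_coordinatewise_then_product)
    fix i
    show "continuous_on A (\<lambda>x. if i \<in> I
        then \<Sum>c\<in>Basis. (a \<bullet> c + x (h (i, c)) * ((b - a) \<bullet> c)) *\<^sub>R c else 0)"
      by (cases "i \<in> I") (auto intro!: continuous_intros
            continuous_on_subset[OF continuous_on_product_coordinates])
  qed
  have contR: "continuous_on A R" for A
    unfolding R_def divide_inverse
    by (intro continuous_on_coordinatewise_then_product continuous_intros
          continuous_on_subset[OF continuous_on_product_coordinates]) auto
  obtain x where x: "x \<in> Pi {..<n} (\<lambda>_. {0..1})" and fixed: "\<And>k. k < n \<Longrightarrow> (R \<circ> f \<circ> T) x k = x k"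
  proof (rule brouwer_nat_cube[of n "R \<circ> f \<circ> T"])
    show "continuous_on (Pi {..<n} (\<lambda>_. {0..1})) (R \<circ> f \<circ> T)"
      by (intro continuous_on_compose contT contR continuous_on_subset[OF cont]) (use TC in auto)
  qed (use TC RC f in auto)
  have "f (T x) i = T x i" if "i \<in> I" for i
  proof -
    have "f (T x) i = T (R (f (T x))) i"
      using TR[OF f[OF TC[OF x]]] that by simp
    also have "\<dots> = T x i"
    proof -
      have "R (f (T x)) (h (i, c)) = x (h (i, c))" if "c \<in> Basis" for c
        using fixed eh(2)[OF \<open>i \<in> I\<close> that] by simp
      then show ?thesis
        by (simp add: T_def[THEN fun_cong])
    qed
    finally show ?thesis .
  qed
  then show ?thesis
    using that TC[OF x] by blast
qed

section \<open>Solvability of the collocation equations\<close>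

text \<open>
  The bound on the right-hand side bounds the values of the stage map by a constant \<open>r\<close>, wherever
  the map is evaluated. It therefore sends the box of half-width \<open>r\<close> into itself, and Brouwer's
  theorem applies.
\<close>

lemma implicit_rk_stages_exist:
  fixes g :: "nat \<Rightarrow> 'a::euclidean_space \<Rightarrow> 'a"
  assumes cont: "\<And>j. j \<le> p \<Longrightarrow> continuous_on UNIV (g j)"
    and bd: "\<And>j y. j \<le> p \<Longrightarrow> norm (g j y) \<le> B"
  obtains Y where "\<And>i. i \<le> p \<Longrightarrow> Y i = y0 + h *\<^sub>R nodal_act p A (\<lambda>j. g j (Y j)) i"
proof -
  define f where "f = (\<lambda>Y i. y0 + h *\<^sub>R nodal_act p A (\<lambda>j. g j (Y j)) i)"
  define r where "r = norm y0 + \<bar>h\<bar> * (\<Sum>i\<le>p. \<Sum>j\<le>p. \<bar>A i j\<bar> * B)"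
  have "0 \<le> B"
    using bd[of 0 0] norm_ge_zero order_trans by blast
  have fr: "norm (f Y i) \<le> r" if "i \<le> p" for Y i
  proof -
    have "norm (nodal_act p A (\<lambda>j. g j (Y j)) i) \<le> (\<Sum>j\<le>p. \<bar>A i j\<bar> * B)"
      unfolding nodal_act_def by (rule sum_norm_le) (auto intro!: mult_left_mono bd)
    also have "\<dots> \<le> (\<Sum>i\<le>p. \<Sum>j\<le>p. \<bar>A i j\<bar> * B)"
      using that \<open>0 \<le> B\<close> by (intro member_le_sum) (auto intro!: sum_nonneg)
    finally have "norm (h *\<^sub>R nodal_act p A (\<lambda>j. g j (Y j)) i)
        \<le> \<bar>h\<bar> * (\<Sum>i\<le>p. \<Sum>j\<le>p. \<bar>A i j\<bar> * B)"
      by (simp add: mult_left_mono)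
    then show ?thesis
      unfolding f_def r_def by (rule norm_triangle_mono[OF order_refl])
  qed
  have box: "y \<in> cbox (- r *\<^sub>R One) (r *\<^sub>R One)" if "norm y \<le> r" for y :: 'a
    using that Basis_le_norm[of _ y] by (fastforce simp: mem_box abs_le_iff)
  have cf: "continuous_on X f" for X
    unfolding f_def nodal_act_def
    by (intro continuous_on_coordinatewise_then_product continuous_intros
          continuous_on_compose2[OF cont] continuous_on_subset[OF continuous_on_product_coordinates])
      auto
  obtain Y where "\<And>i. i \<in> {..p} \<Longrightarrow> f Y i = Y i"
  proof (rule brouwer_finite_product[of "{..p}" "- r *\<^sub>R One" "r *\<^sub>R One" f])
    show "cbox (- r *\<^sub>R One) (r *\<^sub>R One :: 'a) \<noteq> {}"
      using box fr[of 0] by blast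
    show "f Y \<in> Pi {..p} (\<lambda>_. cbox (- r *\<^sub>R One) (r *\<^sub>R One))" for Y
      using box fr by auto
  qed (use cf in auto)
  then show ?thesis
    using that[of Y] by (simp add: f_def)
qed

text \<open>
  The stages of an element depend on the preceding elements through one value, the last stage, so
  the solution is built by recursion over the elements, choosing the stages anew in each of them.
\<close>

lemma lobatto_IIIA_exists:
  fixes f :: "real \<Rightarrow> 'a::euclidean_space \<Rightarrow> 'a"
  assumes cont: "\<And>K j. K < N \<Longrightarrow> j \<le> p \<Longrightarrow> continuous_on UNIV (f (mesh_node \<xi> xl \<Delta> K j))"
    and bd: "\<And>K j y. K < N \<Longrightarrow> j \<le> p \<Longrightarrow> norm (f (mesh_node \<xi> xl \<Delta> K j) y) \<le> B"
  obtains Y where "lobatto_IIIA N p \<xi> xl \<Delta> f y0 Y"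
proof -
  have "\<exists>Z. K < N \<longrightarrow> (\<forall>i\<le>p. Z i = y
      + \<Delta> *\<^sub>R nodal_act p (int_mat p \<xi>) (\<lambda>j. f (mesh_node \<xi> xl \<Delta> K j) (Z j)) i)" for K y
    using implicit_rk_stages_exist[of p "\<lambda>j. f (mesh_node \<xi> xl \<Delta> K j)" B y \<Delta> "int_mat p \<xi>"]
      cont bd by metis
  then obtain step where step: "\<And>K y i. K < N \<Longrightarrow> i \<le> p \<Longrightarrow> step K y i = y
      + \<Delta> *\<^sub>R nodal_act p (int_mat p \<xi>) (\<lambda>j. f (mesh_node \<xi> xl \<Delta> K j) (step K y j)) i"
    by metis
  define Y where "Y = rec_nat (step 0 y0) (\<lambda>K Z. step (Suc K) (Z p))"
  have "Y K = step K (if K = 0 then y0 else Y (K - 1) p)" for K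
    by (cases K) (simp_all add: Y_def)
  then have "lobatto_IIIA N p \<xi> xl \<Delta> f y0 Y"
    unfolding lobatto_IIIA_def using step by metis
  then show ?thesis by (rule that)
qed

section \<open>Steady states of the global flux scheme\<close>

lemma mesh_node_in_domain:
  assumes "strict_mono_on {..p} \<xi>" "\<xi> 0 = 0" "\<xi> p = 1" "0 < \<Delta>" "K < N" "j \<le> p"
  shows "mesh_node \<xi> xl \<Delta> K j \<in> {xl..xl + real N * \<Delta>}"
proof -
  have "mono_on {..p} \<xi>"
    using assms(1) by (rule strict_mono_on_imp_mono_on)
  then have "\<xi> 0 \<le> \<xi> j" "\<xi> j \<le> \<xi> p"
    using assms(6) by (auto intro: mono_onD)
  moreover have "real K + 1 \<le> real N"
    using assms(5) by linarith
  ultimately have "0 \<le> real K + \<xi> j" "real K + \<xi> j \<le> real N"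
    using assms(2,3) by linarith+
  then show ?thesis
    using assms(4) by (auto simp: mesh_node_def mult.commute)
qed

theorem proposition3:
  fixes N p :: nat
    and \<xi> w :: "nat \<Rightarrow> real"
    and xl \<Delta> :: real
    and \<Omega> \<Phi> :: "(real^'m) set"
    and flux :: "real^'m \<Rightarrow> real^'m"
    and S :: "real^'m \<Rightarrow> 'd::real_normed_vector \<Rightarrow> real^'m"
    and \<phi> :: "real \<Rightarrow> 'd"
    and \<alpha> \<D> :: "nat \<Rightarrow> nat \<Rightarrow> real^'m^'m"
    and F0 U0 :: "real^'m"
  defines "Uinv \<equiv> the_inv_into \<Omega> flux"
  assumes "1 \<le> p" and "1 \<le> N" and "0 < \<Delta>"
    and "gauss_lobatto p \<xi> w"
    and "continuous_on {xl..xl + real N * \<Delta>} \<phi>"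
    and "\<forall>K<N. \<forall>i\<in>{0, p}. \<forall>v. v \<noteq> 0 \<longrightarrow> 0 < v \<bullet> (\<D> K i *v v)"
    and "bij_betw flux \<Omega> \<Phi>" and "bounded (Uinv ` \<Phi>)"
    and "U0 \<in> \<Omega>" and "flux U0 = F0"
  shows "(\<forall>F. lobatto_IIIA N p \<xi> xl \<Delta> (\<lambda>x y. S (Uinv y) (\<phi> x)) F0 F
              \<and> (\<forall>K<N. \<forall>i\<le>p. F K i \<in> \<Phi>)
            \<longrightarrow> continuous_steady_state N p \<xi> w xl \<Delta> flux S \<phi> \<alpha> \<D> (\<lambda>K i. Uinv (F K i))
              \<and> Uinv (F 0 0) = U0)
       \<and> (\<Phi> = UNIV \<and> open \<Omega> \<and> continuous_on \<Omega> flux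
              \<and> continuous_on (closure \<Omega> \<times> \<phi> ` {xl..xl + real N * \<Delta>}) (\<lambda>(u, z). S u z)
            \<longrightarrow> (\<exists>F. lobatto_IIIA N p \<xi> xl \<Delta> (\<lambda>x y. S (Uinv y) (\<phi> x)) F0 F
                  \<and> continuous_steady_state N p \<xi> w xl \<Delta> flux S \<phi> \<alpha> \<D> (\<lambda>K i. Uinv (F K i))
                  \<and> Uinv (F 0 0) = U0))"
proof -
  have nodes: "strict_mono_on {..p} \<xi>" "\<xi> 0 = 0" "\<xi> p = 1"
    using \<open>gauss_lobatto p \<xi> w\<close> by (auto simp: gauss_lobatto_def)
  have inj: "inj_on flux \<Omega>" and im: "flux ` \<Omega> = \<Phi>"
    using \<open>bij_betw flux \<Omega> \<Phi>\<close> by (auto simp: bij_betw_def)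
  have Uinv_flux: "Uinv (flux u) = u" if "u \<in> \<Omega>" for u
    unfolding Uinv_def using inj that by (rule the_inv_into_f_f)
  have flux_Uinv: "flux (Uinv y) = y" if "y \<in> \<Phi>" for y
    unfolding Uinv_def using inj that im by (auto intro: f_the_inv_into_f)
  have steady: "continuous_steady_state N p \<xi> w xl \<Delta> flux S \<phi> \<alpha> \<D> (\<lambda>K i. Uinv (F K i))
      \<and> Uinv (F 0 0) = U0"
    if lob: "lobatto_IIIA N p \<xi> xl \<Delta> (\<lambda>x y. S (Uinv y) (\<phi> x)) F0 F"
      and mem: "\<forall>K<N. \<forall>i\<le>p. F K i \<in> \<Phi>" for F
  proof
    show "continuous_steady_state N p \<xi> w xl \<Delta> flux S \<phi> \<alpha> \<D> (\<lambda>K i. Uinv (F K i))"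
      using \<open>gauss_lobatto p \<xi> w\<close> lob
      by (rule lobatto_IIIA_steady_state[where u = Uinv and S = S and \<phi> = \<phi> and z = F0])
        (use mem flux_Uinv in blast)
    have "F 0 0 = F0"
      using lobatto_IIIA_first_stage[OF lob _ nodes(2), of 0] \<open>1 \<le> N\<close> by simp
    then show "Uinv (F 0 0) = U0"
      using Uinv_flux[OF \<open>U0 \<in> \<Omega>\<close>] \<open>flux U0 = F0\<close> by simp
  qed
  have "\<exists>F. lobatto_IIIA N p \<xi> xl \<Delta> (\<lambda>x y. S (Uinv y) (\<phi> x)) F0 F"
    if \<Phi>: "\<Phi> = UNIV" and op: "open \<Omega>" and cflux: "continuous_on \<Omega> flux"
      and cS: "continuous_on (closure \<Omega> \<times> \<phi> ` {xl..xl + real N * \<Delta>}) (\<lambda>(u, z). S u z)"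
  proof -
    let ?Q = "closure \<Omega> \<times> \<phi> ` {xl..xl + real N * \<Delta>}"
    have Uinv_mem: "Uinv y \<in> \<Omega>" for y
      using Uinv_flux im \<Phi> by (metis UNIV_I image_iff)
    have cU: "continuous_on UNIV Uinv"
      using continuous_on_inverse_open[OF op cflux, of Uinv] Uinv_flux im \<Phi> by simp
    \<comment> \<open>The bounded inverse is used here: the states form a bounded set, so its closure is compact.\<close>
    have "\<Omega> \<subseteq> Uinv ` \<Phi>"
      using Uinv_flux \<Phi> by (metis UNIV_I image_iff subsetI)
    then have "bounded \<Omega>"
      using \<open>bounded (Uinv ` \<Phi>)\<close> bounded_subset by blast
    then have "compact ?Q"
      using \<open>continuous_on {xl..xl + real N * \<Delta>} \<phi>\<close>
      by (intro compact_Times compact_continuous_image) auto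
    then have "bounded ((\<lambda>(u, z). S u z) ` ?Q)"
      by (intro compact_imp_bounded compact_continuous_image cS)
    then obtain B where B: "\<And>u z. (u, z) \<in> ?Q \<Longrightarrow> norm (S u z) \<le> B"
      unfolding bounded_iff by fastforce
    have memQ: "(Uinv y, \<phi> (mesh_node \<xi> xl \<Delta> K j)) \<in> ?Q" if "K < N" "j \<le> p" for K j y
      using mesh_node_in_domain[OF nodes \<open>0 < \<Delta>\<close> that] Uinv_mem closure_subset by blast
    obtain F where "lobatto_IIIA N p \<xi> xl \<Delta> (\<lambda>x y. S (Uinv y) (\<phi> x)) F0 F"
    proof (rule lobatto_IIIA_exists[of N p "\<lambda>x y. S (Uinv y) (\<phi> x)" \<xi> xl \<Delta> B F0])
      show "continuous_on UNIV (\<lambda>y. S (Uinv y) (\<phi> (mesh_node \<xi> xl \<Delta> K j)))"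
        if "K < N" "j \<le> p" for K j
      proof -
        have "continuous_on UNIV (\<lambda>y. (Uinv y, \<phi> (mesh_node \<xi> xl \<Delta> K j)))"
          by (intro continuous_intros cU)
        from continuous_on_compose2[OF cS this] show ?thesis
          using memQ[OF that] by auto
      qed
    qed (use B memQ in blast)+
    then show ?thesis by blast
  qed
  with steady show ?thesis
    by blast
qed

end
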